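(* Let $\mu=\mu_1\otimes\cdots\otimes\mu_n$ be the standard Gaussian measure on $\mathbb{R}^n$. Let $f:\mathbb{R}^n\to\mathcal{H}_d$ be such that all of its matrix coefficients, together with their partial derivatives, are smooth and in $L^2(\mu)$. Then $$\mathrm{Var}_\mu(f)\preceq\int\sum_{i=1}^n(\partial_if)^2\,d\mu,$$ where $\partial_if(x_1,\dots,x_n)=\frac{\partial f}{\partial x_i}(x_1,\dots,x_n)$ is the matrix whose entries are the $i$-th partial derivatives of the corresponding entries of $f$.
   Context: $\mathcal{H}_d$ is the set of $d\times d$ Hermitian matrices and $\preceq$ is the positive semi-definite order. Integrals of matrix-valued functions are taken entrywise, squares are matrix squares, and $\mathrm{Var}_\mu(f)=\mathbb{E}_\mu[f^2]-(\mathbb{E}_\mu f)^2$ with $\mathbb{E}_\mu f=\int f\,d\mu$. *)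

theory Defs
  imports "HOL-Probability.Probability"
begin

definition std_gaussian :: "(real ^ 'n::finite) measure" where
  "std_gaussian =
     distr (\<Pi>\<^sub>M i\<in>UNIV. density lborel (\<lambda>t. ennreal (std_normal_density t))) borel
       (\<lambda>g. \<chi> i. g i)"

definition hermitian :: "complex ^ 'd ^ 'd \<Rightarrow> bool" where
  "hermitian A \<longleftrightarrow> (\<forall>j k. A $ j $ k = cnj (A $ k $ j))"

text \<open>For Hermitian \<open>A\<close> the form \<open>v\<^sup>* A v\<close> is real, so taking its real part loses nothing.\<close>

definition positive_semidefinite :: "complex ^ 'd::finite ^ 'd \<Rightarrow> bool" where
  "positive_semidefinite A \<longleftrightarrow>
     hermitian A \<and> (\<forall>v :: complex ^ 'd. 0 \<le> Re (\<Sum>j\<in>UNIV. cnj (v $ j) * (A *v v) $ j))"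

definition psd_le :: "complex ^ 'd::finite ^ 'd \<Rightarrow> complex ^ 'd ^ 'd \<Rightarrow> bool"
    (infix "\<preceq>" 50) where
  "A \<preceq> B \<longleftrightarrow> positive_semidefinite (B - A)"

definition partial_deriv ::
    "'n \<Rightarrow> (real ^ 'n::finite \<Rightarrow> 'b::real_normed_vector) \<Rightarrow> real ^ 'n \<Rightarrow> 'b" where
  "partial_deriv i g x = vector_derivative (\<lambda>t. g (x + t *\<^sub>R axis i 1)) (at 0)"

definition matrix_partial_deriv ::
    "'n \<Rightarrow> (real ^ 'n::finite \<Rightarrow> complex ^ 'd ^ 'd) \<Rightarrow> real ^ 'n \<Rightarrow> complex ^ 'd ^ 'd" where
  "matrix_partial_deriv i f x = (\<chi> j k. partial_deriv i (\<lambda>y. f y $ j $ k) x)"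

text \<open>
  \<open>C_k k g\<close> says that \<open>g\<close> is of class \<open>C\<^sup>k\<close>. Total differentiability is required at each
  stage because \<^const>\<open>partial_deriv\<close> returns a junk value where the derivative does not exist.
\<close>

primrec C_k :: "nat \<Rightarrow> (real ^ 'n::finite \<Rightarrow> 'b::real_normed_vector) \<Rightarrow> bool" where
  "C_k 0 g \<longleftrightarrow> continuous_on UNIV g"
| "C_k (Suc k) g \<longleftrightarrow> (\<forall>x. g differentiable (at x)) \<and> (\<forall>i. C_k k (partial_deriv i g))"

definition smooth :: "(real ^ 'n::finite \<Rightarrow> 'b::real_normed_vector) \<Rightarrow> bool" where
  "smooth g \<longleftrightarrow> (\<forall>k. C_k k g)"

definition square_integrable :: "'a measure \<Rightarrow> ('a \<Rightarrow> complex) \<Rightarrow> bool" where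
  "square_integrable M g \<longleftrightarrow> g \<in> borel_measurable M \<and> integrable M (\<lambda>x. (cmod (g x))\<^sup>2)"

text \<open>
  The Bochner integral of a non-integrable entry is \<open>0\<close>; when all entries of \<open>F\<close> are square
  integrable over a finite measure, the entries of both \<open>F\<close> and \<open>F ** F\<close> are integrable.
\<close>

definition matrix_integral :: "'a measure \<Rightarrow> ('a \<Rightarrow> complex ^ 'd ^ 'd) \<Rightarrow> complex ^ 'd ^ 'd" where
  "matrix_integral M F = (\<chi> j k. \<integral>x. F x $ j $ k \<partial>M)"

definition matrix_variance ::
    "'a measure \<Rightarrow> ('a \<Rightarrow> complex ^ 'd::finite ^ 'd) \<Rightarrow> complex ^ 'd ^ 'd" where
  "matrix_variance M F =
     matrix_integral M (\<lambda>x. F x ** F x) - matrix_integral M F ** matrix_integral M F"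

end

theory Submission
  imports Defs "HOL-Real_Asymp.Real_Asymp"
begin

text \<open>
  For \<open>v \<in> \<complex>\<^sup>d\<close> and Hermitian \<open>A\<close> one has \<open>v\<^sup>* A\<^sup>2 v = \<bar>A v\<bar>\<^sup>2\<close>, so the claim is the Gaussian Poincare
  inequality for the components of \<open>f v\<close>. That inequality is proved in the symmetric form
  \<open>\<integral>\<integral> \<bar>g x - g y\<bar>\<^sup>2 \<le> 2 \<Sum>\<^sub>i \<integral> \<bar>\<partial>\<^sub>i g\<bar>\<^sup>2\<close>. In dimension one, \<open>\<bar>h y - h x\<bar>\<^sup>2 \<le> (y - x) \<integral>\<^sub>x\<^sup>y \<bar>h'\<bar>\<^sup>2\<close>; after
  exchanging integrals the weight of \<open>\<bar>h' t\<bar>\<^sup>2\<close> is twice the integral of \<open>y - x\<close> over \<open>x < t < y\<close>, and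
  this integral is exactly the Gaussian density at \<open>t\<close>. The passage to \<open>n\<close> dimensions is the Efron-Stein inequality, obtained
  by integrating the quadrilateral inequality over pairs of points.
\<close>

section \<open>The Gaussian Poincare inequality on the real line\<close>

text \<open>Cauchy-Schwarz applied to the fundamental theorem of calculus. The bound is an integral
  over the whole line with an indicator, so that its order can later be exchanged with the integrals
  over \<open>x\<close> and \<open>y\<close>.\<close>

lemma norm_diff_sq_le_nn_integral:
  fixes h :: "real \<Rightarrow> 'b::euclidean_space"
  assumes deriv: "\<And>t. (h has_vector_derivative h' t) (at t)"
    and cont: "continuous_on UNIV h'" and "x < y"
  shows "ennreal ((norm (h y - h x))\<^sup>2) \<le>
    (\<integral>\<^sup>+t. ennreal (y - x) * indicator {x<..<y} t * ennreal ((norm (h' t))\<^sup>2) \<partial>lborel)"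
proof -
  define a where "a = h y - h x"
  define I where "I = integral {x..y} (\<lambda>t. (norm (h' t))\<^sup>2)"
  have cont': "continuous_on {x..y} h'"
    using cont continuous_on_subset by blast
  have "(h' has_integral a) {x..y}"
    unfolding a_def using \<open>x < y\<close> deriv
    by (intro fundamental_theorem_of_calculus) (auto intro: has_vector_derivative_at_within)
  then have inner: "((\<lambda>t. h' t \<bullet> a) has_integral (a \<bullet> a)) {x..y}"
    using has_integral_linear[OF _ bounded_linear_inner_left[of a]] by (simp add: o_def)
  have sq: "((\<lambda>t. (norm (h' t))\<^sup>2) has_integral I) {x..y}"
    unfolding I_def by (intro integrable_integral integrable_continuous_real continuous_intros cont')
  have const: "((\<lambda>t. a \<bullet> a) has_integral (y - x) * (a \<bullet> a)) {x..y}"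
    using has_integral_const_real[of "a \<bullet> a" x y] \<open>x < y\<close> by simp
  \<comment> \<open>Expand \<open>0 \<le> \<integral>\<bar>(y - x) h' - a\<bar>\<^sup>2\<close>.\<close>
  have "((\<lambda>t. (y - x)\<^sup>2 * (norm (h' t))\<^sup>2 - (2 * (y - x)) * (h' t \<bullet> a) + a \<bullet> a) has_integral
      ((y - x)\<^sup>2 * I - (2 * (y - x)) * (a \<bullet> a) + (y - x) * (a \<bullet> a))) {x..y}"
    by (intro has_integral_add has_integral_diff has_integral_mult_right sq inner const)
  moreover have "0 \<le> (y - x)\<^sup>2 * (norm (h' t))\<^sup>2 - (2 * (y - x)) * (h' t \<bullet> a) + a \<bullet> a" for t
  proof -
    have "0 \<le> ((y - x) *\<^sub>R h' t - a) \<bullet> ((y - x) *\<^sub>R h' t - a)" by simp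
    also have "\<dots> = (y - x)\<^sup>2 * (norm (h' t))\<^sup>2 - (2 * (y - x)) * (h' t \<bullet> a) + a \<bullet> a"
      unfolding power2_norm_eq_inner
      by (simp add: inner_diff_left inner_diff_right power2_eq_square inner_commute algebra_simps)
    finally show ?thesis .
  qed
  ultimately have "0 \<le> (y - x)\<^sup>2 * I - (2 * (y - x)) * (a \<bullet> a) + (y - x) * (a \<bullet> a)"
    using has_integral_nonneg by blast
  also have "\<dots> = (y - x) * ((y - x) * I - a \<bullet> a)"
    by (simp add: power2_eq_square algebra_simps)
  finally have le: "(norm a)\<^sup>2 \<le> (y - x) * I"
    using \<open>x < y\<close> by (simp add: zero_le_mult_iff power2_norm_eq_inner)
  have "((\<lambda>t. (y - x) * (norm (h' t))\<^sup>2) has_integral (y - x) * I) {x<..<y}"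
    using has_integral_mult_right[OF sq] by (simp add: has_integral_Icc_iff_Ioo)
  then have "(\<integral>\<^sup>+t. ennreal ((y - x) * (norm (h' t))\<^sup>2) * indicator {x<..<y} t \<partial>lborel) =
      ennreal ((y - x) * I)"
    using \<open>x < y\<close> by (intro nn_integral_has_integral_lebesgue') auto
  also have "(\<integral>\<^sup>+t. ennreal ((y - x) * (norm (h' t))\<^sup>2) * indicator {x<..<y} t \<partial>lborel) =
      (\<integral>\<^sup>+t. ennreal (y - x) * indicator {x<..<y} t * ennreal ((norm (h' t))\<^sup>2) \<partial>lborel)"
    using \<open>x < y\<close> by (intro nn_integral_cong) (simp add: ennreal_mult mult_ac)
  finally show ?thesis
    using le by (simp add: a_def ennreal_leI)
qed

abbreviation gauss1 :: "real measure" where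
  "gauss1 \<equiv> density lborel (\<lambda>t. ennreal (std_normal_density t))"

lemma prob_space_gauss1: "prob_space gauss1"
  using prob_space_normal_density[of 1 0] by simp

text \<open>This makes \<open>std_normal_density\<close> an antiderivative of
  \<open>- (t * std_normal_density t)\<close>, which evaluates the Gaussian means over half
  lines.\<close>

lemma std_normal_density_has_derivative:
  "(std_normal_density has_real_derivative - (t * std_normal_density t)) (at t)"
  unfolding std_normal_density_def
  by (auto intro!: derivative_eq_intros simp: field_simps)

lemma std_normal_density_tendsto_0_at_top: "(std_normal_density \<longlongrightarrow> 0) at_top"
  unfolding std_normal_density_def by real_asymp

lemma std_normal_density_tendsto_0_at_bot: "(std_normal_density \<longlongrightarrow> 0) at_bot"
  unfolding std_normal_density_def by real_asymp

lemma integrable_gauss1_id: "integrable gauss1 (\<lambda>y. y)"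
  using integrable_std_normal_moment[of 1] by (subst integrable_real_density) auto

lemma isCont_std_normal_moment: "isCont (\<lambda>y. - (y * std_normal_density y)) x"
  unfolding std_normal_density_def by (intro continuous_intros) auto

lemma set_integrable_std_normal_moment:
  "A \<in> sets borel \<Longrightarrow> set_integrable lborel A (\<lambda>y. - (y * std_normal_density y))"
  using integrable_std_normal_moment[of 1] unfolding set_integrable_def
  by (intro integrable_mult_indicator) (auto simp: mult.commute)

text \<open>The antiderivative vanishes at infinity, so only its boundary value at \<open>t\<close>
  survives.\<close>

lemma gauss1_upper_mean:
  "(\<integral>y. y * indicator {t<..} y \<partial>gauss1) = std_normal_density t"
proof -
  have "(LBINT y=t..\<infinity>. - (y * std_normal_density y)) = 0 - std_normal_density t"
  \<comment> \<open>This form of the fundamental theorem asks for one-sided limits at both extended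
    real endpoints; at the finite one the limit comes from continuity.\<close>
  proof (rule interval_integral_FTC_integrable)
    show "((std_normal_density \<circ> real_of_ereal) \<longlongrightarrow> std_normal_density t) (at_right (ereal t))"
      unfolding ereal_tendsto_simps
      using DERIV_isCont[OF std_normal_density_has_derivative, of t]
      by (simp add: isCont_def filterlim_at_within_not_equal filterlim_at_split)
    show "((std_normal_density \<circ> real_of_ereal) \<longlongrightarrow> 0) (at_left \<infinity>)"
      unfolding ereal_tendsto_simps by (rule std_normal_density_tendsto_0_at_top)
  qed (auto intro: std_normal_density_has_derivative isCont_std_normal_moment
      set_integrable_std_normal_moment simp: has_real_derivative_iff_has_vector_derivative[symmetric])
  then show ?thesis
    by (subst integral_real_density)
      (auto simp: interval_lebesgue_integral_def set_lebesgue_integral_def mult_ac)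
qed

lemma gauss1_lower_mean:
  "(\<integral>y. y * indicator {..<t} y \<partial>gauss1) = - std_normal_density t"
proof -
  have "(LBINT y=-\<infinity>..t. - (y * std_normal_density y)) = std_normal_density t - 0"
  proof (rule interval_integral_FTC_integrable)
    show "((std_normal_density \<circ> real_of_ereal) \<longlongrightarrow> std_normal_density t) (at_left (ereal t))"
      unfolding ereal_tendsto_simps
      using DERIV_isCont[OF std_normal_density_has_derivative, of t]
      by (simp add: isCont_def filterlim_at_within_not_equal filterlim_at_split)
    show "((std_normal_density \<circ> real_of_ereal) \<longlongrightarrow> 0) (at_right (-\<infinity>))"
      unfolding ereal_tendsto_simps by (rule std_normal_density_tendsto_0_at_bot)
  qed (auto intro: std_normal_density_has_derivative isCont_std_normal_moment
      set_integrable_std_normal_moment simp: has_real_derivative_iff_has_vector_derivative[symmetric])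
  then show ?thesis
    by (subst integral_real_density)
      (auto simp: interval_lebesgue_integral_def set_lebesgue_integral_def mult_ac)
qed

text \<open>
  With \<open>\<alpha>\<close>, \<open>\<beta>\<close> the masses of the two half lines cut at \<open>t\<close>, the inner integral is
  \<open>\<phi>(t) - x \<beta>\<close> for \<open>x < t\<close>, and integrating this over \<open>x < t\<close> gives \<open>\<phi>(t) (\<alpha> + \<beta>) = \<phi>(t)\<close>.
\<close>

lemma gauss1_kernel:
  "(\<integral>\<^sup>+x. \<integral>\<^sup>+y. ennreal (y - x) * indicator {x<..<y} t \<partial>gauss1 \<partial>gauss1) =
     ennreal (std_normal_density t)"
proof -
  interpret prob_space gauss1 by (rule prob_space_gauss1)
  define \<alpha> \<beta> where "\<alpha> = measure gauss1 {..<t}" and "\<beta> = measure gauss1 {t<..}"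
  have int_ind: "integrable gauss1 (\<lambda>y. indicator A y :: real)" if "A \<in> sets borel" for A
    using that by (intro integrable_real_indicator) (auto simp: emeasure_eq_measure)
  have int_id: "integrable gauss1 (\<lambda>y. y * indicator A y)" if "A \<in> sets borel" for A
    using integrable_mult_indicator[OF _ integrable_gauss1_id, of A] that by (simp add: mult.commute)
  have "\<alpha> + \<beta> = measure gauss1 ({..<t} \<union> {t<..})"
    unfolding \<alpha>_def \<beta>_def by (subst finite_measure_Union) auto
  \<comment> \<open>The single point \<open>t\<close> is a null set, so the two open half lines
    carry the full mass.\<close>
  also have "\<dots> = measure gauss1 (space gauss1)"
    by (intro finite_measure_eq_AE) (auto simp: AE_density intro: eventually_mono[OF AE_lborel_singleton[of t]])
  finally have sum: "\<alpha> + \<beta> = 1" using prob_space by simp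
  have upper: "(\<integral>y. (y - x) * indicator {t<..} y \<partial>gauss1) = std_normal_density t - x * \<beta>"
    "integrable gauss1 (\<lambda>y. (y - x) * indicator {t<..} y)" for x
    using gauss1_upper_mean[of t] int_ind[of "{t<..}"] int_id[of "{t<..}"]
    by (simp_all add: left_diff_distrib \<beta>_def)
  have lower: "(\<integral>x. (std_normal_density t - x * \<beta>) * indicator {..<t} x \<partial>gauss1) = std_normal_density t"
    "integrable gauss1 (\<lambda>x. (std_normal_density t - x * \<beta>) * indicator {..<t} x)"
  proof -
    have eq: "(std_normal_density t - x * \<beta>) * indicator {..<t} x =
        std_normal_density t * indicator {..<t} x - \<beta> * (x * indicator {..<t} x)" for x
      by (simp add: algebra_simps)
    have "(\<integral>x. (std_normal_density t - x * \<beta>) * indicator {..<t} x \<partial>gauss1) =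
        std_normal_density t * \<alpha> + \<beta> * std_normal_density t"
      unfolding eq using gauss1_lower_mean[of t] int_ind[of "{..<t}"] int_id[of "{..<t}"]
      by (simp add: \<alpha>_def)
    also have "\<dots> = std_normal_density t * (\<alpha> + \<beta>)" by (simp add: algebra_simps)
    finally show "(\<integral>x. (std_normal_density t - x * \<beta>) * indicator {..<t} x \<partial>gauss1) = std_normal_density t"
      using sum by simp
    show "integrable gauss1 (\<lambda>x. (std_normal_density t - x * \<beta>) * indicator {..<t} x)"
      unfolding eq using int_ind[of "{..<t}"] int_id[of "{..<t}"] by simp
  qed
  \<comment> \<open>The value is an integral of \<open>y - x\<close> over \<open>y > t > x\<close>.
    The sign matters because \<open>ennreal\<close> sends negative numbers to 0.\<close>
  have nonneg: "0 \<le> std_normal_density t - x * \<beta>" if "x < t" for x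
    unfolding upper(1)[symmetric] using that
    by (intro integral_nonneg_AE) (auto simp: indicator_def)
  have "(\<integral>\<^sup>+y. ennreal (y - x) * indicator {x<..<y} t \<partial>gauss1) =
      ennreal ((std_normal_density t - x * \<beta>) * indicator {..<t} x)" for x
  \<comment> \<open>If \<open>x \<ge> t\<close>, then \<open>t\<close> lies in no interval
    \<open>{x<..<y}\<close> and both sides are 0.\<close>
  proof (cases "x < t")
    case True
    have "(\<integral>\<^sup>+y. ennreal (y - x) * indicator {x<..<y} t \<partial>gauss1) =
        (\<integral>\<^sup>+y. ennreal ((y - x) * indicator {t<..} y) \<partial>gauss1)"
      using True by (intro nn_integral_cong) (auto simp: indicator_def)
    also have "\<dots> = ennreal (std_normal_density t - x * \<beta>)"
      unfolding upper(1)[symmetric] using True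
      by (intro nn_integral_eq_integral upper(2)) (auto simp: indicator_def)
    finally show ?thesis using True by simp
  qed simp
  then have "(\<integral>\<^sup>+x. \<integral>\<^sup>+y. ennreal (y - x) * indicator {x<..<y} t \<partial>gauss1 \<partial>gauss1) =
      (\<integral>\<^sup>+x. ennreal ((std_normal_density t - x * \<beta>) * indicator {..<t} x) \<partial>gauss1)"
    by simp
  also have "\<dots> = ennreal (\<integral>x. (std_normal_density t - x * \<beta>) * indicator {..<t} x \<partial>gauss1)"
    using nonneg by (intro nn_integral_eq_integral lower(2)) (auto simp: indicator_def)
  finally show ?thesis unfolding lower(1) .
qed

text \<open>With values in \<open>ennreal\<close>, Tonelli's theorem applies without any
  integrability assumption. The factor 2 counts the two orderings of \<open>x\<close> and
  \<open>y\<close>, each contributing one kernel integral.\<close>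

lemma gauss1_poincare_nn:
  fixes h :: "real \<Rightarrow> 'b::euclidean_space"
  assumes deriv: "\<And>t. (h has_vector_derivative h' t) (at t)"
    and cont: "continuous_on UNIV h'"
  shows "(\<integral>\<^sup>+x. \<integral>\<^sup>+y. ennreal ((norm (h x - h y))\<^sup>2) \<partial>gauss1 \<partial>gauss1) \<le>
    2 * (\<integral>\<^sup>+t. ennreal ((norm (h' t))\<^sup>2) \<partial>gauss1)"
proof -
  interpret prob_space gauss1 by (rule prob_space_gauss1)
  interpret P: pair_sigma_finite gauss1 gauss1 ..
  interpret L: pair_sigma_finite gauss1 lborel ..
  have [measurable]: "h' \<in> borel_measurable borel"
    using cont by (rule borel_measurable_continuous_onI)
  define K where "K x y t = ennreal (y - x) * indicator {x<..<y} t" for x y t :: real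
  define D where "D t = ennreal ((norm (h' t))\<^sup>2)" for t
  have D[measurable]: "D \<in> borel_measurable borel" unfolding D_def by measurable
  have K: "(\<lambda>(x, y, t). K x y t) \<in> borel_measurable (borel \<Otimes>\<^sub>M borel \<Otimes>\<^sub>M borel)"
  proof -
    \<comment> \<open>The interval in the indicator moves with \<open>x\<close> and
      \<open>y\<close>; as two strict comparisons it is visibly jointly measurable.\<close>
    have "(\<lambda>(x, y, t). K x y t) = (\<lambda>(x, y, t). ennreal (y - x) * (if x < t \<and> t < y then 1 else 0))"
      by (auto simp: K_def fun_eq_iff)
    then show ?thesis by simp
  qed
  have Km[measurable (raw)]: "(\<lambda>z. K (a z) (b z) (c z)) \<in> borel_measurable M"
    if [measurable]: "a \<in> borel_measurable M" "b \<in> borel_measurable M" "c \<in> borel_measurable M"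
    for a b c and M :: "'x measure"
  proof -
    have "(\<lambda>z. (a z, b z, c z)) \<in> M \<rightarrow>\<^sub>M borel \<Otimes>\<^sub>M borel \<Otimes>\<^sub>M borel" by measurable
    from measurable_compose[OF this K] show ?thesis by simp
  qed
  \<comment> \<open>\<open>G x y\<close> vanishes unless \<open>x < y\<close>, so
    \<open>G x y + G y x\<close> covers both orderings in one formula.\<close>
  define G where "G x y = (\<integral>\<^sup>+t. K x y t * D t \<partial>lborel)" for x y
  have [measurable]: "(\<lambda>(x, y). G x y) \<in> borel_measurable (gauss1 \<Otimes>\<^sub>M gauss1)"
    unfolding G_def by measurable
  have "ennreal ((norm (h x - h y))\<^sup>2) \<le> G x y + G y x" for x y
  proof (cases x y rule: linorder_cases)
    case less
    then show ?thesis
      using norm_diff_sq_le_nn_integral[OF deriv cont less]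
      by (auto simp: G_def K_def D_def norm_minus_commute intro: order_trans)
  next
    case greater
    then show ?thesis
      using norm_diff_sq_le_nn_integral[OF deriv cont greater]
      by (auto simp: G_def K_def D_def intro: order_trans)
  qed simp
  then have "(\<integral>\<^sup>+x. \<integral>\<^sup>+y. ennreal ((norm (h x - h y))\<^sup>2) \<partial>gauss1 \<partial>gauss1) \<le>
      (\<integral>\<^sup>+x. \<integral>\<^sup>+y. G x y + G y x \<partial>gauss1 \<partial>gauss1)"
    by (intro nn_integral_mono)
  also have "\<dots> = (\<integral>\<^sup>+x. \<integral>\<^sup>+y. G x y \<partial>gauss1 \<partial>gauss1) + (\<integral>\<^sup>+x. \<integral>\<^sup>+y. G y x \<partial>gauss1 \<partial>gauss1)"
    by (simp add: nn_integral_add)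
  also have "(\<integral>\<^sup>+x. \<integral>\<^sup>+y. G y x \<partial>gauss1 \<partial>gauss1) = (\<integral>\<^sup>+x. \<integral>\<^sup>+y. G x y \<partial>gauss1 \<partial>gauss1)"
    by (rule P.Fubini') measurable
  \<comment> \<open>Two exchanges move the integral over \<open>t\<close> outermost, where the
    kernel integrates to the Gaussian density.\<close>
  also have "(\<integral>\<^sup>+x. \<integral>\<^sup>+y. G x y \<partial>gauss1 \<partial>gauss1) =
      (\<integral>\<^sup>+x. \<integral>\<^sup>+t. \<integral>\<^sup>+y. K x y t * D t \<partial>gauss1 \<partial>lborel \<partial>gauss1)"
    unfolding G_def by (intro nn_integral_cong L.Fubini'[symmetric]) measurable
  also have "\<dots> = (\<integral>\<^sup>+t. \<integral>\<^sup>+x. \<integral>\<^sup>+y. K x y t * D t \<partial>gauss1 \<partial>gauss1 \<partial>lborel)"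
    by (intro L.Fubini'[symmetric]) measurable
  also have "\<dots> = (\<integral>\<^sup>+t. ennreal (std_normal_density t) * D t \<partial>lborel)"
    using gauss1_kernel by (simp add: nn_integral_multc K_def[symmetric])
  also have "\<dots> = (\<integral>\<^sup>+t. D t \<partial>gauss1)"
    by (simp add: nn_integral_density)
  finally show ?thesis by (simp add: D_def mult_2)
qed

section \<open>Tensorization and the Efron-Stein inequality\<close>

text \<open>The right side minus the left side is the squared norm of \<open>a + b - c - d\<close>.
  For the quadrilateral with successive vertices \<open>a\<close>, \<open>c\<close>,
  \<open>b\<close>, \<open>d\<close>, the diagonals are on the left and the sides on the
  right.\<close>

lemma norm_diff_sq_quadrilateral:
  fixes a b c d :: "'b::real_inner"
  shows "(norm (a - b))\<^sup>2 + (norm (c - d))\<^sup>2 \<le>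
    (norm (a - c))\<^sup>2 + (norm (a - d))\<^sup>2 + (norm (b - c))\<^sup>2 + (norm (b - d))\<^sup>2"
proof -
  have "0 \<le> (a + b - c - d) \<bullet> (a + b - c - d)" by simp
  then show ?thesis
    unfolding power2_norm_eq_inner
    by (simp add: inner_diff_left inner_diff_right inner_add_left inner_add_right inner_commute)
qed

text \<open>Take the quadrilateral with diagonals \<open>F x y\<close>, \<open>F x' y'\<close> and
  \<open>F x' y\<close>, \<open>F x y'\<close>. A diagonal changes both coordinates, a side only
  one. After integration each diagonal gives \<open>?V\<close>, two sides give \<open>?V1\<close>
  and the other two give \<open>?V2\<close>, so the claim appears with a common factor 2.\<close>

lemma (in pair_prob_space) variance_tensor_nn:
  fixes F :: "'a \<Rightarrow> 'b \<Rightarrow> 'c::{real_inner, second_countable_topology}"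
  assumes F: "(\<lambda>(x, y). F x y) \<in> borel_measurable (M1 \<Otimes>\<^sub>M M2)"
  shows "(\<integral>\<^sup>+x. \<integral>\<^sup>+y. \<integral>\<^sup>+x'. \<integral>\<^sup>+y'. ennreal ((norm (F x y - F x' y'))\<^sup>2) \<partial>M2 \<partial>M1 \<partial>M2 \<partial>M1) \<le>
    (\<integral>\<^sup>+y. \<integral>\<^sup>+x. \<integral>\<^sup>+x'. ennreal ((norm (F x y - F x' y))\<^sup>2) \<partial>M1 \<partial>M1 \<partial>M2) +
    (\<integral>\<^sup>+x. \<integral>\<^sup>+y. \<integral>\<^sup>+y'. ennreal ((norm (F x y - F x y'))\<^sup>2) \<partial>M2 \<partial>M2 \<partial>M1)"
    (is "?V \<le> ?V1 + ?V2")
proof -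
  interpret P11: pair_sigma_finite M1 M1 ..
  interpret P22: pair_sigma_finite M2 M2 ..
  define N where "N a b = ennreal ((norm (a - b))\<^sup>2)" for a b :: 'c
  have N_commute: "N a b = N b a" for a b by (simp add: N_def norm_minus_commute)
  have [measurable (raw)]: "(\<lambda>z. F (a z) (b z)) \<in> borel_measurable M"
    if "a \<in> M \<rightarrow>\<^sub>M M1" "b \<in> M \<rightarrow>\<^sub>M M2" for a b and M :: "'x measure"
    using measurable_compose[OF measurable_Pair[OF that] F] by simp
  have [measurable (raw)]: "(\<lambda>z. N (a z) (b z)) \<in> borel_measurable M"
    if "a \<in> borel_measurable M" "b \<in> borel_measurable M" for a b and M :: "'x measure"
    using that unfolding N_def by measurable
  \<comment> \<open>A common order of integration for all six terms. Keeping the two copies of each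
    space adjacent lets them be swapped by Fubini.\<close>
  let ?S = "\<lambda>H. \<integral>\<^sup>+x. \<integral>\<^sup>+x'. \<integral>\<^sup>+y. \<integral>\<^sup>+y'. H x y x' y' \<partial>M2 \<partial>M2 \<partial>M1 \<partial>M1"
  have S_add: "?S (\<lambda>x y x' y'. H x y x' y' + H' x y x' y') = ?S H + ?S H'"
    if H: "(\<lambda>(x, x', y, y'). H x y x' y') \<in> borel_measurable (M1 \<Otimes>\<^sub>M M1 \<Otimes>\<^sub>M M2 \<Otimes>\<^sub>M M2)"
      and H': "(\<lambda>(x, x', y, y'). H' x y x' y') \<in> borel_measurable (M1 \<Otimes>\<^sub>M M1 \<Otimes>\<^sub>M M2 \<Otimes>\<^sub>M M2)"
    for H H' :: "'a \<Rightarrow> 'b \<Rightarrow> 'a \<Rightarrow> 'b \<Rightarrow> ennreal"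
  proof -
    have Hm [measurable (raw)]:
      "(\<lambda>z. H (a z) (b z) (c z) (d z)) \<in> borel_measurable M"
      "(\<lambda>z. H' (a z) (b z) (c z) (d z)) \<in> borel_measurable M"
      if [measurable]: "a \<in> M \<rightarrow>\<^sub>M M1" "b \<in> M \<rightarrow>\<^sub>M M2" "c \<in> M \<rightarrow>\<^sub>M M1" "d \<in> M \<rightarrow>\<^sub>M M2"
      for a b c d and M :: "'x measure"
      using measurable_compose[of "\<lambda>z. (a z, c z, b z, d z)" M, OF _ H]
        measurable_compose[of "\<lambda>z. (a z, c z, b z, d z)" M, OF _ H'] by simp_all
    \<comment> \<open>Additivity is carried outward one integral at a time, since every level has
      its own measurability condition.\<close>
    have 1: "(\<integral>\<^sup>+y'. H x y x' y' + H' x y x' y' \<partial>M2) = (\<integral>\<^sup>+y'. H x y x' y' \<partial>M2) + (\<integral>\<^sup>+y'. H' x y x' y' \<partial>M2)"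
      if "x \<in> space M1" "x' \<in> space M1" "y \<in> space M2" for x x' y
      using that by (intro nn_integral_add) measurable
    have 2: "(\<integral>\<^sup>+y. \<integral>\<^sup>+y'. H x y x' y' + H' x y x' y' \<partial>M2 \<partial>M2) =
        (\<integral>\<^sup>+y. \<integral>\<^sup>+y'. H x y x' y' \<partial>M2 \<partial>M2) + (\<integral>\<^sup>+y. \<integral>\<^sup>+y'. H' x y x' y' \<partial>M2 \<partial>M2)"
      if [measurable]: "x \<in> space M1" "x' \<in> space M1" for x x'
      using that by (subst nn_integral_add[symmetric]) (measurable, auto intro!: nn_integral_cong simp: 1)
    have 3: "(\<integral>\<^sup>+x'. \<integral>\<^sup>+y. \<integral>\<^sup>+y'. H x y x' y' + H' x y x' y' \<partial>M2 \<partial>M2 \<partial>M1) =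
        (\<integral>\<^sup>+x'. \<integral>\<^sup>+y. \<integral>\<^sup>+y'. H x y x' y' \<partial>M2 \<partial>M2 \<partial>M1) +
        (\<integral>\<^sup>+x'. \<integral>\<^sup>+y. \<integral>\<^sup>+y'. H' x y x' y' \<partial>M2 \<partial>M2 \<partial>M1)"
      if [measurable]: "x \<in> space M1" for x
      using that by (subst nn_integral_add[symmetric]) (measurable, auto intro!: nn_integral_cong simp: 2)
    show ?thesis
      by (subst nn_integral_add[symmetric]) (measurable, auto intro!: nn_integral_cong simp: 3)
  qed
  have V: "?S (\<lambda>x y x' y'. N (F x y) (F x' y')) = ?V"
    unfolding N_def[symmetric] by (intro nn_integral_cong Fubini'[symmetric]) measurable
  \<comment> \<open>Exchanging \<open>x\<close> and \<open>x'\<close> turns the second diagonal into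
    the first.\<close>
  have V': "?S (\<lambda>x y x' y'. N (F x' y) (F x y')) = ?V"
    unfolding V[symmetric] by (rule P11.Fubini') measurable
  have A: "?S (\<lambda>x y x' y'. N (F x y) (F x' y)) = ?V1"
  proof -
    have "?S (\<lambda>x y x' y'. N (F x y) (F x' y)) =
        (\<integral>\<^sup>+x. \<integral>\<^sup>+x'. \<integral>\<^sup>+y. N (F x y) (F x' y) \<partial>M2 \<partial>M1 \<partial>M1)"
      \<comment> \<open>The integrand is constant in \<open>y'\<close>, and \<open>M2\<close> has
        total mass 1.\<close>
      by (simp add: M2.emeasure_space_1)
    also have "\<dots> = (\<integral>\<^sup>+x. \<integral>\<^sup>+y. \<integral>\<^sup>+x'. N (F x y) (F x' y) \<partial>M1 \<partial>M2 \<partial>M1)"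
      by (intro nn_integral_cong Fubini'[symmetric]) measurable
    also have "\<dots> = ?V1"
      unfolding N_def[symmetric] by (rule Fubini'[symmetric]) measurable
    finally show ?thesis .
  qed
  have A': "?S (\<lambda>x y x' y'. N (F x' y') (F x y')) = ?V1"
  proof -
    have "?S (\<lambda>x y x' y'. N (F x' y') (F x y')) = ?S (\<lambda>x y x' y'. N (F x y) (F x' y))"
      unfolding N_commute[of "F x' y'" "F x y'" for x x' y']
      by (intro nn_integral_cong P22.Fubini') measurable
    with A show ?thesis by simp
  qed
  have B: "?S (\<lambda>x y x' y'. N (F x y) (F x y')) = ?V2"
    by (simp add: M1.emeasure_space_1 N_def)
  have B': "?S (\<lambda>x y x' y'. N (F x' y') (F x' y)) = ?V2"
    unfolding N_commute[of "F x' y'" "F x' y" for x' y' y]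
    by (simp add: M1.emeasure_space_1 N_def)
  have quad: "N a b + N c d \<le> (N a c + N a d) + (N b c + N b d)" for a b c d
    using norm_diff_sq_quadrilateral[of a b c d] by (simp add: N_def ennreal_leI add.assoc flip: ennreal_plus)
  have "2 * ?V = ?S (\<lambda>x y x' y'. N (F x y) (F x' y')) + ?S (\<lambda>x y x' y'. N (F x' y) (F x y'))"
    unfolding V V' by (simp add: mult_2)
  also have "\<dots> = ?S (\<lambda>x y x' y'. N (F x y) (F x' y') + N (F x' y) (F x y'))"
    by (rule S_add[symmetric]) measurable
  also have "\<dots> \<le> ?S (\<lambda>x y x' y'. (N (F x y) (F x' y) + N (F x y) (F x y')) +
      (N (F x' y') (F x' y) + N (F x' y') (F x y')))"
    by (intro nn_integral_mono quad)
  also have "\<dots> = ?S (\<lambda>x y x' y'. N (F x y) (F x' y) + N (F x y) (F x y')) +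
      ?S (\<lambda>x y x' y'. N (F x' y') (F x' y) + N (F x' y') (F x y'))"
    by (rule S_add) measurable
  also have "?S (\<lambda>x y x' y'. N (F x y) (F x' y) + N (F x y) (F x y')) =
      ?S (\<lambda>x y x' y'. N (F x y) (F x' y)) + ?S (\<lambda>x y x' y'. N (F x y) (F x y'))"
    by (rule S_add) measurable
  also have "?S (\<lambda>x y x' y'. N (F x' y') (F x' y) + N (F x' y') (F x y')) =
      ?S (\<lambda>x y x' y'. N (F x' y') (F x' y)) + ?S (\<lambda>x y x' y'. N (F x' y') (F x y'))"
    by (rule S_add) measurable
  also have "(?S (\<lambda>x y x' y'. N (F x y) (F x' y)) + ?S (\<lambda>x y x' y'. N (F x y) (F x y'))) +
      (?S (\<lambda>x y x' y'. N (F x' y') (F x' y)) + ?S (\<lambda>x y x' y'. N (F x' y') (F x y'))) =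
      2 * (?V1 + ?V2)"
    unfolding A A' B B' by (simp add: mult_2 ac_simps)
  \<comment> \<open>The factor 2 is neither 0 nor infinite, so it cancels in
    \<open>ennreal\<close>.\<close>
  finally show ?thesis
    by (simp add: ennreal_mult_le_mult_iff del: distrib_left_numeral)
qed

text \<open>Induction on \<open>J\<close>. Tensorization splits off the coordinate \<open>i\<close>:
  one part is the term that resamples \<open>i\<close>, the other fixes the value \<open>t\<close>
  of that coordinate and is bounded by the induction hypothesis for the section
  \<open>x \<mapsto> g (x(i := t))\<close>.\<close>

lemma (in product_prob_space) efron_stein_nn:
  fixes g :: "('i \<Rightarrow> 'a) \<Rightarrow> 'b::{real_inner, second_countable_topology}"
  assumes "finite J" "g \<in> borel_measurable (PiM J M)"
  shows "(\<integral>\<^sup>+x. \<integral>\<^sup>+y. ennreal ((norm (g x - g y))\<^sup>2) \<partial>PiM J M \<partial>PiM J M) \<le>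
    (\<Sum>i\<in>J. \<integral>\<^sup>+x. \<integral>\<^sup>+t. ennreal ((norm (g x - g (x(i := t))))\<^sup>2) \<partial>M i \<partial>PiM J M)"
  using assms
proof (induction J arbitrary: g rule: finite_induct)
  case empty
  then show ?case by (simp add: nn_integral_empty)
next
  case (insert i J)
  note [measurable] = insert.prems
  interpret PJ: prob_space "PiM J M" by (intro prob_space_PiM prob_space)
  interpret P: pair_prob_space "PiM J M" "M i" ..
  define N where "N a b = ennreal ((norm (a - b))\<^sup>2)" for a b :: 'b
  have [measurable (raw)]: "(\<lambda>z. N (a z) (b z)) \<in> borel_measurable L"
    if "a \<in> borel_measurable L" "b \<in> borel_measurable L" for a b and L :: "'x measure"
    using that unfolding N_def by measurable
  let ?PI = "PiM (insert i J) M"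
  have [measurable]: "(\<lambda>p. (fst p)(k := snd p)) \<in> ?PI \<Otimes>\<^sub>M M k \<rightarrow>\<^sub>M ?PI" if "k \<in> insert i J" for k
    using that by (intro measurable_fun_upd[where J = "insert i J"]) auto
  have upd: "(\<lambda>z. \<integral>\<^sup>+s. N (g z) (g (z(k := s))) \<partial>M k) \<in> borel_measurable ?PI"
    if [measurable]: "k \<in> insert i J" for k
  proof -
    have "(\<lambda>p. N (g (fst p)) (g ((fst p)(k := snd p)))) \<in> borel_measurable (?PI \<Otimes>\<^sub>M M k)"
      using that by measurable
    then show ?thesis
      by (intro sigma_finite_measure.borel_measurable_nn_integral sigma_finite_measures)
        (simp add: split_beta')
  qed
  have [measurable]: "(\<lambda>p. (fst p)(i := snd p)) \<in> PiM J M \<Otimes>\<^sub>M M i \<rightarrow>\<^sub>M ?PI"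
    by (intro measurable_fun_upd[where J = J]) auto
  have F: "(\<lambda>(x, t). g (x(i := t))) \<in> borel_measurable (PiM J M \<Otimes>\<^sub>M M i)"
    by (simp add: split_beta')
  have sec: "(\<lambda>x. g (x(i := t))) \<in> borel_measurable (PiM J M)" if "t \<in> space (M i)" for t
    using measurable_compose[OF measurable_Pair[OF measurable_ident_sets measurable_const] F] that
    by simp
  have "(\<integral>\<^sup>+x. \<integral>\<^sup>+y. N (g x) (g y) \<partial>?PI \<partial>?PI) =
      (\<integral>\<^sup>+x. \<integral>\<^sup>+t. \<integral>\<^sup>+x'. \<integral>\<^sup>+t'. N (g (x(i := t))) (g (x'(i := t')))
        \<partial>M i \<partial>PiM J M \<partial>M i \<partial>PiM J M)"
  proof -
    interpret PI: prob_space ?PI by (intro prob_space_PiM prob_space)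
    have "(\<integral>\<^sup>+y. N a (g y) \<partial>?PI) = (\<integral>\<^sup>+x'. \<integral>\<^sup>+t'. N a (g (x'(i := t'))) \<partial>M i \<partial>PiM J M)" for a
      using insert.hyps by (intro product_nn_integral_insert) measurable
    moreover have "(\<integral>\<^sup>+x. \<integral>\<^sup>+y. N (g x) (g y) \<partial>?PI \<partial>?PI) =
      (\<integral>\<^sup>+x. \<integral>\<^sup>+t. \<integral>\<^sup>+y. N (g (x(i := t))) (g y) \<partial>?PI \<partial>M i \<partial>PiM J M)"
      using insert.hyps by (intro product_nn_integral_insert) measurable
    ultimately show ?thesis by simp
  qed
  also have "\<dots> \<le>
      (\<integral>\<^sup>+t. \<integral>\<^sup>+x. \<integral>\<^sup>+x'. N (g (x(i := t))) (g (x'(i := t))) \<partial>PiM J M \<partial>PiM J M \<partial>M i) +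
      (\<integral>\<^sup>+x. \<integral>\<^sup>+t. \<integral>\<^sup>+t'. N (g (x(i := t))) (g (x(i := t'))) \<partial>M i \<partial>M i \<partial>PiM J M)"
    unfolding N_def by (rule P.variance_tensor_nn[OF F])
  \<comment> \<open>Read \<open>z\<close> as \<open>x(i := t)\<close>: a second update at
    \<open>i\<close> forgets \<open>t\<close>, so the resampled point is
    \<open>x(i := t')\<close>.\<close>
  also have "(\<integral>\<^sup>+x. \<integral>\<^sup>+t. \<integral>\<^sup>+t'. N (g (x(i := t))) (g (x(i := t'))) \<partial>M i \<partial>M i \<partial>PiM J M) =
      (\<integral>\<^sup>+z. \<integral>\<^sup>+s. N (g z) (g (z(i := s))) \<partial>M i \<partial>?PI)"
    using insert.hyps by (subst product_nn_integral_insert) (auto intro: upd)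
  also have "(\<integral>\<^sup>+t. \<integral>\<^sup>+x. \<integral>\<^sup>+x'. N (g (x(i := t))) (g (x'(i := t))) \<partial>PiM J M \<partial>PiM J M \<partial>M i) \<le>
      (\<integral>\<^sup>+t. (\<Sum>k\<in>J. \<integral>\<^sup>+x. \<integral>\<^sup>+s. N (g (x(i := t))) (g ((x(k := s))(i := t))) \<partial>M k \<partial>PiM J M) \<partial>M i)"
    unfolding N_def by (intro nn_integral_mono insert.IH sec)
  \<comment> \<open>Since \<open>i\<close> is not in \<open>J\<close>, the updates commute. Then
    \<open>x(i := t)\<close> occurs only as a whole and can be merged into one point
    \<open>z\<close> of the larger product.\<close>
  also have "\<dots> =
      (\<integral>\<^sup>+t. (\<Sum>k\<in>J. \<integral>\<^sup>+x. \<integral>\<^sup>+s. N (g (x(i := t))) (g ((x(i := t))(k := s))) \<partial>M k \<partial>PiM J M) \<partial>M i)"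
  proof -
    have "x(k := s, i := t) = x(i := t, k := s)" if "k \<in> J" for x :: "'i \<Rightarrow> 'a" and k s t
      using that insert.hyps by (auto intro: fun_upd_twist)
    then show ?thesis by simp
  qed
  also have "\<dots> =
      (\<Sum>k\<in>J. \<integral>\<^sup>+t. \<integral>\<^sup>+x. \<integral>\<^sup>+s. N (g (x(i := t))) (g ((x(i := t))(k := s))) \<partial>M k \<partial>PiM J M \<partial>M i)"
  proof (intro nn_integral_sum)
    fix k assume "k \<in> J"
    then have "(\<lambda>p. \<integral>\<^sup>+s. N (g ((snd p)(i := fst p))) (g (((snd p)(i := fst p))(k := s))) \<partial>M k)
        \<in> borel_measurable (M i \<Otimes>\<^sub>M PiM J M)"
      by (intro measurable_compose[OF _ upd] measurable_fun_upd[where J = J]) auto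
    then show "(\<lambda>t. \<integral>\<^sup>+x. \<integral>\<^sup>+s. N (g (x(i := t))) (g ((x(i := t))(k := s))) \<partial>M k \<partial>PiM J M)
        \<in> borel_measurable (M i)"
      by (intro PJ.borel_measurable_nn_integral) (simp add: split_beta')
  qed
  also have "\<dots> = (\<Sum>k\<in>J. \<integral>\<^sup>+z. \<integral>\<^sup>+s. N (g z) (g (z(k := s))) \<partial>M k \<partial>?PI)"
    using insert.hyps
    by (intro sum.cong refl product_nn_integral_insert_rev[symmetric] upd) auto
  finally show ?case
    unfolding N_def by (simp only: sum.insert[OF insert.hyps] add.commute add_left_mono add_right_mono)
qed

section \<open>The Gaussian Poincare inequality in several dimensions\<close>

text \<open>Resetting coordinate \<open>i\<close> to 0 gives a base point independent of
  \<open>t\<close>, so updating becomes motion along a line parallel to an axis.\<close>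

lemma vec_lambda_upd:
  fixes x :: "'n::finite \<Rightarrow> real"
  shows "(\<chi> j. (x(i := t)) j) = (\<chi> j. (x(i := 0)) j) + t *\<^sub>R axis i 1"
  by (simp add: vec_eq_iff axis_def)

lemma measurable_vec_lambda_gauss1:
  "(\<lambda>x. \<chi> j. x j) \<in> (\<Pi>\<^sub>M i\<in>UNIV. gauss1) \<rightarrow>\<^sub>M (borel :: (real ^ 'n::finite) measure)"
proof -
  have eq: "(\<chi> j. x j) = (\<Sum>j\<in>UNIV. x j *\<^sub>R axis j (1::real))" for x :: "'n \<Rightarrow> real"
    by (simp add: vec_eq_iff axis_def if_distrib cong: if_cong)
  have "(\<lambda>x. x j) \<in> (\<Pi>\<^sub>M i\<in>UNIV. gauss1) \<rightarrow>\<^sub>M (borel :: real measure)" for j :: 'n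
    using measurable_component_singleton[of j UNIV "\<lambda>_. gauss1"] by simp
  then show ?thesis
    unfolding eq by (intro borel_measurable_sum borel_measurable_scaleR borel_measurable_const)
qed

lemma prob_space_std_gaussian: "prob_space (std_gaussian :: (real ^ 'n::finite) measure)"
  unfolding std_gaussian_def
  by (intro prob_space.prob_space_distr prob_space_PiM prob_space_gauss1 measurable_vec_lambda_gauss1)

lemma sets_std_gaussian [measurable_cong]: "sets std_gaussian = sets borel"
  by (simp add: std_gaussian_def)

text \<open>Efron-Stein reduces the left side to resampling single coordinates. With the other
  coordinates fixed, each term is the one-dimensional inequality along a line parallel to an
  axis.\<close>

lemma gaussian_poincare_nn:
  fixes g :: "real ^ 'n::finite \<Rightarrow> 'b::euclidean_space"
  assumes deriv: "\<And>i c s. ((\<lambda>t. g (c + t *\<^sub>R axis i 1)) has_vector_derivative g' i (c + s *\<^sub>R axis i 1)) (at s)"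
    and cont: "continuous_on UNIV g" "\<And>i. continuous_on UNIV (g' i)"
  shows "(\<integral>\<^sup>+x. \<integral>\<^sup>+y. ennreal ((norm (g x - g y))\<^sup>2) \<partial>std_gaussian \<partial>std_gaussian) \<le>
    2 * (\<Sum>i\<in>UNIV. \<integral>\<^sup>+x. ennreal ((norm (g' i x))\<^sup>2) \<partial>std_gaussian)"
proof -
  interpret product_prob_space "\<lambda>_ :: 'n. gauss1" UNIV
    by (intro product_prob_spaceI prob_space_gauss1)
  let ?P = "\<lambda>J :: 'n set. PiM J (\<lambda>_. gauss1)"
  define v :: "('n \<Rightarrow> real) \<Rightarrow> real ^ 'n" where "v x = (\<chi> j. x j)" for x
  have v [measurable]: "v \<in> ?P UNIV \<rightarrow>\<^sub>M borel"
    unfolding v_def by (rule measurable_vec_lambda_gauss1)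
  have v_upd: "v (x(i := t)) = v (x(i := 0)) + t *\<^sub>R axis i 1" for x i t
    unfolding v_def by (rule vec_lambda_upd)
  have [measurable]: "g \<in> borel_measurable borel" "\<And>i. g' i \<in> borel_measurable borel"
    using cont by (auto intro: borel_measurable_continuous_onI)
  have std: "(\<integral>\<^sup>+x. H x \<partial>std_gaussian) = (\<integral>\<^sup>+x. H (v x) \<partial>?P UNIV)"
    if "H \<in> borel_measurable borel" for H :: "real ^ 'n \<Rightarrow> ennreal"
    unfolding std_gaussian_def v_def
    by (rule nn_integral_distr[OF measurable_vec_lambda_gauss1]) (use that in simp)
  interpret G: prob_space "std_gaussian :: (real ^ 'n) measure"
    by (rule prob_space_std_gaussian)
  have "(\<integral>\<^sup>+x. \<integral>\<^sup>+y. ennreal ((norm (g x - g y))\<^sup>2) \<partial>std_gaussian \<partial>std_gaussian) =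
      (\<integral>\<^sup>+x. \<integral>\<^sup>+y. ennreal ((norm (g (v x) - g (v y)))\<^sup>2) \<partial>?P UNIV \<partial>?P UNIV)"
  proof -
    have "(\<lambda>x. \<integral>\<^sup>+y. ennreal ((norm (g x - g y))\<^sup>2) \<partial>std_gaussian) \<in> borel_measurable borel"
      by (intro G.borel_measurable_nn_integral) measurable
    then show ?thesis by (simp add: std)
  qed
  also have "\<dots> \<le> (\<Sum>i\<in>UNIV. \<integral>\<^sup>+x. \<integral>\<^sup>+t. ennreal ((norm (g (v x) - g (v (x(i := t)))))\<^sup>2) \<partial>gauss1 \<partial>?P UNIV)"
    by (rule efron_stein_nn) measurable
  also have "\<dots> \<le> (\<Sum>i\<in>UNIV. 2 * (\<integral>\<^sup>+x. ennreal ((norm (g' i x))\<^sup>2) \<partial>std_gaussian))"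
  proof (rule sum_mono)
    fix i :: 'n
    let ?J = "UNIV - {i}"
    have J: "UNIV = insert i ?J" by auto
    have meas: "(\<lambda>x. \<integral>\<^sup>+t. ennreal ((norm (g (v x) - g (v (x(i := t)))))\<^sup>2) \<partial>gauss1)
        \<in> borel_measurable (?P UNIV)"
    proof -
      have [measurable]: "(\<lambda>p. (fst p)(i := snd p)) \<in> ?P UNIV \<Otimes>\<^sub>M gauss1 \<rightarrow>\<^sub>M ?P UNIV"
        by (intro measurable_fun_upd[where J = UNIV]) auto
      have "(\<lambda>p. ennreal ((norm (g (v (fst p)) - g (v ((fst p)(i := snd p)))))\<^sup>2))
          \<in> borel_measurable (?P UNIV \<Otimes>\<^sub>M gauss1)"
        by measurable
      then show ?thesis
        by (intro sigma_finite_measure.borel_measurable_nn_integral sigma_finite_measures)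
          (simp add: split_beta')
    qed
    have insert: "(\<integral>\<^sup>+x. H x \<partial>?P UNIV) = (\<integral>\<^sup>+x. \<integral>\<^sup>+s. H (x(i := s)) \<partial>gauss1 \<partial>?P ?J)"
      if "H \<in> borel_measurable (?P UNIV)" for H
      using product_nn_integral_insert[of ?J i H] that J by (metis Diff_iff finite finite_Diff insertI1)
    \<comment> \<open>Once coordinate \<open>i\<close> is split off, its old value \<open>s\<close>
      and its new value \<open>t\<close> are two independent Gaussian samples.\<close>
    have "(\<integral>\<^sup>+x. \<integral>\<^sup>+t. ennreal ((norm (g (v x) - g (v (x(i := t)))))\<^sup>2) \<partial>gauss1 \<partial>?P UNIV) =
        (\<integral>\<^sup>+x. \<integral>\<^sup>+s. \<integral>\<^sup>+t. ennreal ((norm (g (v (x(i := s))) - g (v (x(i := t)))))\<^sup>2)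
          \<partial>gauss1 \<partial>gauss1 \<partial>?P ?J)"
      by (subst insert[OF meas]) simp
    also have "\<dots> \<le> (\<integral>\<^sup>+x. 2 * (\<integral>\<^sup>+s. ennreal ((norm (g' i (v (x(i := s)))))\<^sup>2) \<partial>gauss1) \<partial>?P ?J)"
    proof (rule nn_integral_mono)
      fix x :: "'n \<Rightarrow> real"
      have "continuous_on UNIV (\<lambda>s. g' i (v (x(i := 0)) + s *\<^sub>R axis i 1))"
        by (intro continuous_on_compose2[OF cont(2)] continuous_intros) auto
      then show "(\<integral>\<^sup>+s. \<integral>\<^sup>+t. ennreal ((norm (g (v (x(i := s))) - g (v (x(i := t)))))\<^sup>2)
          \<partial>gauss1 \<partial>gauss1) \<le> 2 * (\<integral>\<^sup>+s. ennreal ((norm (g' i (v (x(i := s)))))\<^sup>2) \<partial>gauss1)"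
        by (subst (1 2 3) v_upd) (intro gauss1_poincare_nn deriv)
    qed
    also have "\<dots> = 2 * (\<integral>\<^sup>+x. ennreal ((norm (g' i (v x)))\<^sup>2) \<partial>?P UNIV)"
    proof -
      have [measurable]: "(\<lambda>p. (fst p)(i := snd p)) \<in> ?P ?J \<Otimes>\<^sub>M gauss1 \<rightarrow>\<^sub>M ?P UNIV"
        by (intro measurable_fun_upd[where J = ?J]) auto
      have "(\<lambda>p. ennreal ((norm (g' i (v ((fst p)(i := snd p)))))\<^sup>2))
          \<in> borel_measurable (?P ?J \<Otimes>\<^sub>M gauss1)"
        by measurable
      then have "(\<lambda>x. \<integral>\<^sup>+s. ennreal ((norm (g' i (v (x(i := s)))))\<^sup>2) \<partial>gauss1)
          \<in> borel_measurable (?P ?J)"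
        by (intro sigma_finite_measure.borel_measurable_nn_integral sigma_finite_measures)
          (simp add: split_beta')
      then show ?thesis
        by (subst insert) (simp_all add: nn_integral_cmult)
    qed
    also have "\<dots> = 2 * (\<integral>\<^sup>+x. ennreal ((norm (g' i x))\<^sup>2) \<partial>std_gaussian)"
      by (simp add: std)
    finally show "(\<integral>\<^sup>+x. \<integral>\<^sup>+t. ennreal ((norm (g (v x) - g (v (x(i := t)))))\<^sup>2) \<partial>gauss1 \<partial>?P UNIV) \<le>
        2 * (\<integral>\<^sup>+x. ennreal ((norm (g' i x))\<^sup>2) \<partial>std_gaussian)" .
  qed
  finally show ?thesis by (simp add: sum_distrib_left)
qed

section \<open>From double integrals to variances of square integrable functions\<close>

text \<open>Expand the square: each pure term contributes the second moment, and the mixed term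
  becomes the inner product of the mean with itself. The result is twice the variance.\<close>

lemma (in prob_space) nn_integral_norm_diff_sq:
  fixes u :: "'a \<Rightarrow> 'b::euclidean_space"
  assumes [simp]: "integrable M u" "integrable M (\<lambda>x. (norm (u x))\<^sup>2)"
  shows "(\<integral>\<^sup>+x. \<integral>\<^sup>+y. ennreal ((norm (u x - u y))\<^sup>2) \<partial>M \<partial>M) =
    ennreal (2 * ((\<integral>x. (norm (u x))\<^sup>2 \<partial>M) - (norm (\<integral>x. u x \<partial>M))\<^sup>2))"
proof -
  define S m where "S = (\<integral>x. (norm (u x))\<^sup>2 \<partial>M)" and "m = (\<integral>x. u x \<partial>M)"
  have expand: "(norm (a - b))\<^sup>2 = (norm a)\<^sup>2 - 2 * (a \<bullet> b) + (norm b)\<^sup>2" for a b :: 'b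
    by (simp add: power2_norm_eq_inner inner_diff_left inner_diff_right inner_commute)
  have inner: "(\<integral>y. (norm (a - u y))\<^sup>2 \<partial>M) = (norm a)\<^sup>2 - 2 * (a \<bullet> m) + S"
    "integrable M (\<lambda>y. (norm (a - u y))\<^sup>2)" for a
    by (simp_all add: expand S_def m_def prob_space)
  have outer: "(\<integral>x. (norm (u x))\<^sup>2 - 2 * (u x \<bullet> m) + S \<partial>M) = 2 * (S - (norm m)\<^sup>2)"
  proof -
    have "(\<integral>x. (norm (u x))\<^sup>2 - 2 * (u x \<bullet> m) + S \<partial>M) = S - 2 * (m \<bullet> m) + S"
      by (simp add: prob_space S_def m_def)
    also have "\<dots> = 2 * (S - (norm m)\<^sup>2)"
      by (simp add: dot_square_norm)
    finally show ?thesis .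
  qed
  have "(\<integral>\<^sup>+y. ennreal ((norm (a - u y))\<^sup>2) \<partial>M) = ennreal ((norm a)\<^sup>2 - 2 * (a \<bullet> m) + S)" for a
    unfolding inner(1)[symmetric] by (intro nn_integral_eq_integral inner(2)) simp
  moreover have "0 \<le> (norm a)\<^sup>2 - 2 * (a \<bullet> m) + S" for a
    unfolding inner(1)[symmetric] by simp
  then have "(\<integral>\<^sup>+x. ennreal ((norm (u x))\<^sup>2 - 2 * (u x \<bullet> m) + S) \<partial>M) = ennreal (2 * (S - (norm m)\<^sup>2))"
    unfolding outer[symmetric] by (intro nn_integral_eq_integral) simp_all
  ultimately show ?thesis by (simp add: S_def m_def)
qed

lemma square_integrable_mult:
  assumes "square_integrable M g" "square_integrable M h"
  shows "integrable M (\<lambda>x. g x * h x)"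
proof (rule Bochner_Integration.integrable_bound)
  show "integrable M (\<lambda>x. (cmod (g x))\<^sup>2 + (cmod (h x))\<^sup>2)"
    using assms by (simp add: square_integrable_def)
  show "(\<lambda>x. g x * h x) \<in> borel_measurable M"
    using assms by (intro borel_measurable_times) (auto simp: square_integrable_def)
  have "a * b \<le> a\<^sup>2 + b\<^sup>2" if "0 \<le> a" "0 \<le> b" for a b :: real
    using sum_squares_bound[of a b] mult_nonneg_nonneg[OF that] by linarith
  then show "AE x in M. norm (g x * h x) \<le> norm ((cmod (g x))\<^sup>2 + (cmod (h x))\<^sup>2)"
    by (simp add: norm_mult)
qed

lemma (in prob_space) square_integrable_integrable:
  assumes "square_integrable M g"
  shows "integrable M g"
proof -
  have "square_integrable M (\<lambda>_. 1)" by (simp add: square_integrable_def)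
  from square_integrable_mult[OF assms this] show ?thesis by simp
qed

lemma square_integrable_cmult:
  assumes "square_integrable M g"
  shows "square_integrable M (\<lambda>x. g x * c)"
  using assms by (auto simp: square_integrable_def norm_mult power_mult_distrib
      intro: borel_measurable_times)

lemma square_integrable_add:
  assumes "square_integrable M g" "square_integrable M h"
  shows "square_integrable M (\<lambda>x. g x + h x)"
proof -
  have [measurable]: "g \<in> borel_measurable M" "h \<in> borel_measurable M"
    using assms by (auto simp: square_integrable_def)
  have "integrable M (\<lambda>x. (cmod (g x + h x))\<^sup>2)"
  proof (rule Bochner_Integration.integrable_bound)
    show "integrable M (\<lambda>x. 2 * (cmod (g x))\<^sup>2 + 2 * (cmod (h x))\<^sup>2)"
      using assms by (simp add: square_integrable_def)
    have "(cmod (a + b))\<^sup>2 \<le> 2 * (cmod a)\<^sup>2 + 2 * (cmod b)\<^sup>2" for a b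
    proof -
      have "(cmod (a + b))\<^sup>2 \<le> (cmod a + cmod b)\<^sup>2" by (intro power_mono norm_triangle_ineq) auto
      also have "\<dots> \<le> 2 * (cmod a)\<^sup>2 + 2 * (cmod b)\<^sup>2"
        using sum_squares_bound[of "cmod a" "cmod b"] by (simp add: power2_sum)
      finally show ?thesis .
    qed
    then show "AE x in M. norm ((cmod (g x + h x))\<^sup>2) \<le> norm (2 * (cmod (g x))\<^sup>2 + 2 * (cmod (h x))\<^sup>2)"
      by simp
  qed measurable
  then show ?thesis by (simp add: square_integrable_def)
qed

lemma square_integrable_sum:
  assumes "\<And>k. k \<in> A \<Longrightarrow> square_integrable M (g k)"
  shows "square_integrable M (\<lambda>x. \<Sum>k\<in>A. g k x)"
  using assms
proof (induction A rule: infinite_finite_induct)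
  case (insert k A)
  then show ?case by (auto intro: square_integrable_add)
qed (auto simp: square_integrable_def)

text \<open>Square integrability makes all terms finite, so the inequality in \<open>ennreal\<close>
  descends to the reals, where the factor 2 cancels.\<close>

lemma gaussian_poincare:
  fixes u :: "real ^ 'n::finite \<Rightarrow> complex"
  assumes deriv: "\<And>i c s. ((\<lambda>t. u (c + t *\<^sub>R axis i 1)) has_vector_derivative u' i (c + s *\<^sub>R axis i 1)) (at s)"
    and cont: "continuous_on UNIV u" "\<And>i. continuous_on UNIV (u' i)"
    and sq: "square_integrable std_gaussian u" "\<And>i. square_integrable std_gaussian (u' i)"
  shows "(\<integral>x. (cmod (u x))\<^sup>2 \<partial>std_gaussian) - (cmod (\<integral>x. u x \<partial>std_gaussian))\<^sup>2 \<le>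
    (\<Sum>i\<in>UNIV. \<integral>x. (cmod (u' i x))\<^sup>2 \<partial>std_gaussian)" (is "?V \<le> ?D")
proof -
  interpret prob_space "std_gaussian :: (real ^ 'n) measure"
    by (rule prob_space_std_gaussian)
  have "ennreal (2 * ?V) = (\<integral>\<^sup>+x. \<integral>\<^sup>+y. ennreal ((cmod (u x - u y))\<^sup>2) \<partial>std_gaussian \<partial>std_gaussian)"
    using sq(1) by (intro nn_integral_norm_diff_sq[symmetric] square_integrable_integrable)
      (auto simp: square_integrable_def)
  also have "\<dots> \<le> 2 * (\<Sum>i\<in>UNIV. \<integral>\<^sup>+x. ennreal ((cmod (u' i x))\<^sup>2) \<partial>std_gaussian)"
    by (intro gaussian_poincare_nn deriv cont)
  also have "\<dots> = 2 * (\<Sum>i\<in>UNIV. ennreal (\<integral>x. (cmod (u' i x))\<^sup>2 \<partial>std_gaussian))"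
    using sq(2) by (simp add: nn_integral_eq_integral square_integrable_def)
  also have "\<dots> = ennreal (2 * ?D)"
    by (simp add: sum_nonneg ennreal_mult)
  finally show ?thesis
    by (subst (asm) ennreal_le_iff) (auto intro: sum_nonneg)
qed

section \<open>Partial derivatives and Hermitian matrices\<close>

text \<open>Total differentiability identifies \<open>partial_deriv\<close> with the derivative
  applied to the axis vector, and that value does not depend on the base point from which the line
  is parametrized.\<close>

lemma partial_deriv_along_axis:
  assumes "g differentiable (at (c + s *\<^sub>R axis i 1))"
  shows "((\<lambda>t. g (c + t *\<^sub>R axis i 1)) has_vector_derivative partial_deriv i g (c + s *\<^sub>R axis i 1)) (at s)"
proof -
  let ?x = "c + s *\<^sub>R axis i 1"
  obtain D where D: "(g has_derivative D) (at ?x)"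
    using assms by (auto simp: differentiable_def)
  \<comment> \<open>Used twice: from \<open>?x\<close> at parameter 0, as in the definition of
    \<open>partial_deriv\<close>, and from \<open>c\<close> at parameter \<open>s\<close>.\<close>
  have line: "((\<lambda>t. g (y + t *\<^sub>R axis i 1)) has_vector_derivative D (axis i 1)) (at r)"
    if "y + r *\<^sub>R axis i 1 = ?x" for y r
  proof -
    have "((\<lambda>t. y + t *\<^sub>R axis i 1) has_vector_derivative axis i 1) (at r)"
      by (auto intro!: derivative_eq_intros)
    then show ?thesis
      using vector_derivative_diff_chain_within[of "\<lambda>t. y + t *\<^sub>R axis i 1" "axis i 1" r UNIV g D] D that
      by (simp add: o_def has_derivative_at_withinI)
  qed
  have "partial_deriv i g ?x = D (axis i 1)"
    unfolding partial_deriv_def by (rule vector_derivative_at) (rule line, simp)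
  with line[of c s] show ?thesis by simp
qed

lemma hermitian_nth: "hermitian A \<Longrightarrow> A $ j $ k = cnj (A $ k $ j)"
  unfolding hermitian_def by (drule spec, drule spec, assumption)

lemma hermitian_diff:
  assumes "hermitian A" "hermitian B"
  shows "hermitian (A - B)"
  unfolding hermitian_def
proof (intro allI)
  fix j k
  show "(A - B) $ j $ k = cnj ((A - B) $ k $ j)"
    by (simp add: hermitian_nth[OF assms(1), of j k] hermitian_nth[OF assms(2), of j k])
qed

lemma hermitian_sum:
  assumes "\<And>i. i \<in> I \<Longrightarrow> hermitian (A i)"
  shows "hermitian (\<Sum>i\<in>I. A i)"
  unfolding hermitian_def sum_component cnj_sum
  by (intro allI sum.cong refl hermitian_nth assms)

lemma hermitian_square:
  fixes A :: "complex ^ 'd::finite ^ 'd"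
  assumes "hermitian A"
  shows "hermitian (A ** A)"
  unfolding hermitian_def
proof (intro allI)
  fix j k
  have "cnj ((A ** A) $ k $ j) = (\<Sum>l\<in>UNIV. cnj (A $ k $ l) * cnj (A $ l $ j))"
    by (simp add: matrix_matrix_mult_def cnj_sum)
  also have "\<dots> = (\<Sum>l\<in>UNIV. A $ l $ k * A $ j $ l)"
    using assms unfolding hermitian_def by metis
  finally show "(A ** A) $ j $ k = cnj ((A ** A) $ k $ j)"
    by (simp add: matrix_matrix_mult_def mult.commute)
qed

text \<open>Conjugation commutes with the Bochner integral; for a non-integrable entry both sides
  are 0.\<close>

lemma hermitian_matrix_integral:
  assumes "\<And>x. hermitian (F x)"
  shows "hermitian (matrix_integral M F)"
proof -
  have "(\<integral>x. F x $ j $ k \<partial>M) = (\<integral>x. cnj (F x $ k $ j) \<partial>M)" for j k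
    by (rule Bochner_Integration.integral_cong[OF refl]) (rule hermitian_nth[OF assms])
  then show ?thesis
    unfolding hermitian_def matrix_integral_def vec_lambda_beta Bochner_Integration.integral_cnj by (intro allI)
qed

text \<open>Conjugation is bounded and real linear, so it commutes with derivatives that
  exist.\<close>

lemma hermitian_matrix_partial_deriv:
  assumes herm: "\<And>x. hermitian (f x)"
    and diff: "\<And>j k x. (\<lambda>y. f y $ j $ k) differentiable (at x)"
  shows "hermitian (matrix_partial_deriv i f x)"
proof -
  have "partial_deriv i (\<lambda>y. f y $ j $ k) x = cnj (partial_deriv i (\<lambda>y. f y $ k $ j) x)" for j k
  proof -
    have "((\<lambda>t. f (x + t *\<^sub>R axis i 1) $ k $ j) has_vector_derivative
        partial_deriv i (\<lambda>y. f y $ k $ j) (x + 0 *\<^sub>R axis i 1)) (at 0)"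
      by (rule partial_deriv_along_axis[of "\<lambda>y. f y $ k $ j" x 0 i]) (rule diff)
    from has_vector_derivative_cnj[OF this]
    have "((\<lambda>t. f (x + t *\<^sub>R axis i 1) $ j $ k) has_vector_derivative
        cnj (partial_deriv i (\<lambda>y. f y $ k $ j) x)) (at 0)"
      by (simp add: hermitian_nth[OF herm, of _ j k])
    then show ?thesis
      unfolding partial_deriv_def[of i "\<lambda>y. f y $ j $ k"] by (rule vector_derivative_at)
  qed
  then show ?thesis
    unfolding hermitian_def matrix_partial_deriv_def vec_lambda_beta by (intro allI)
qed

section \<open>Quadratic forms of matrix squares and their integrals\<close>

text \<open>The form inside \<open>positive_semidefinite\<close> before its real part is taken; in
  this form it is complex linear in the matrix.\<close>

definition quad_form :: "complex ^ 'd::finite \<Rightarrow> complex ^ 'd ^ 'd \<Rightarrow> complex" where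
  "quad_form v A = (\<Sum>j\<in>UNIV. cnj (v $ j) * (A *v v) $ j)"

lemma quad_form_expand: "quad_form v A = (\<Sum>j\<in>UNIV. \<Sum>k\<in>UNIV. cnj (v $ j) * v $ k * A $ j $ k)"
  by (simp add: quad_form_def matrix_vector_mult_def sum_distrib_left mult_ac)

lemma quad_form_diff: "quad_form v (A - B) = quad_form v A - quad_form v B"
  by (simp add: quad_form_expand right_diff_distrib sum_subtractf)

lemma quad_form_sum: "quad_form v (\<Sum>i\<in>I. A i) = (\<Sum>i\<in>I. quad_form v (A i))"
proof -
  have "quad_form v 0 = 0" "quad_form v (A + B) = quad_form v A + quad_form v B" for A B
    by (simp_all add: quad_form_expand distrib_left sum.distrib)
  then show ?thesis
    by (induction I rule: infinite_finite_induct) simp_all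
qed

lemma quad_form_matrix_integral:
  assumes "\<And>j k. integrable M (\<lambda>x. F x $ j $ k)"
  shows "quad_form v (matrix_integral M F) = (\<integral>x. quad_form v (F x) \<partial>M)"
  using assms by (simp add: quad_form_expand matrix_integral_def)

text \<open>Since \<open>A\<close> equals its adjoint, one of the two factors can be moved onto the
  conjugated vector, leaving the inner product of \<open>A *v v\<close> with itself.\<close>

lemma quad_form_square:
  assumes "hermitian A"
  shows "quad_form v (A ** A) = complex_of_real (\<Sum>j\<in>UNIV. (cmod ((A *v v) $ j))\<^sup>2)"
proof -
  have "quad_form v (A ** A) = (\<Sum>j\<in>UNIV. cnj (v $ j) * (\<Sum>k\<in>UNIV. A $ j $ k * (A *v v) $ k))"
    unfolding quad_form_def matrix_vector_mul_assoc[symmetric]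
    by (simp add: matrix_vector_mult_def)
  also have "\<dots> = (\<Sum>k\<in>UNIV. \<Sum>j\<in>UNIV. cnj (v $ j) * A $ j $ k * (A *v v) $ k)"
    unfolding sum_distrib_left by (subst sum.swap) (simp add: mult.assoc)
  also have "\<dots> = (\<Sum>k\<in>UNIV. cnj ((A *v v) $ k) * (A *v v) $ k)"
  proof (intro sum.cong refl)
    fix k
    have "cnj ((A *v v) $ k) = (\<Sum>j\<in>UNIV. cnj (A $ k $ j) * cnj (v $ j))"
      by (simp add: matrix_vector_mult_def cnj_sum)
    also have "\<dots> = (\<Sum>j\<in>UNIV. cnj (v $ j) * A $ j $ k)"
      by (simp add: hermitian_nth[OF assms, of _ k] mult.commute)
    finally show "(\<Sum>j\<in>UNIV. cnj (v $ j) * A $ j $ k * (A *v v) $ k) = cnj ((A *v v) $ k) * (A *v v) $ k"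
      by (simp add: sum_distrib_right)
  qed
  finally show ?thesis
    by (simp add: complex_norm_square mult.commute del: of_real_power)
qed

lemma integrable_matrix_square:
  assumes "\<And>j k. square_integrable M (\<lambda>x. F x $ j $ k)"
  shows "integrable M (\<lambda>x. (F x ** F x) $ j $ k)"
  using assms by (simp add: matrix_matrix_mult_def square_integrable_mult)

lemma square_integrable_matrix_vector_mult:
  assumes "\<And>j k. square_integrable M (\<lambda>x. F x $ j $ k)"
  shows "square_integrable M (\<lambda>x. (F x *v v) $ j)"
  unfolding matrix_vector_mult_def using assms
  by (simp add: square_integrable_sum square_integrable_cmult)

text \<open>This turns the integral of a matrix square into scalar second moments, the quantities in
  the scalar Poincare inequality.\<close>

lemma quad_form_integral_square:
  assumes herm: "\<And>x. hermitian (F x)"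
    and sq: "\<And>j k. square_integrable M (\<lambda>x. F x $ j $ k)"
  shows "quad_form v (matrix_integral M (\<lambda>x. F x ** F x)) =
    complex_of_real (\<Sum>j\<in>UNIV. \<integral>x. (cmod ((F x *v v) $ j))\<^sup>2 \<partial>M)"
proof -
  have "integrable M (\<lambda>x. (cmod ((F x *v v) $ j))\<^sup>2)" for j
    using square_integrable_matrix_vector_mult[OF sq, of v j] by (simp add: square_integrable_def)
  then show ?thesis
    by (simp add: quad_form_matrix_integral integrable_matrix_square[OF sq] quad_form_square[OF herm]
        del: of_real_sum of_real_power)
qed

section \<open>The matrix inequality\<close>

theorem theorem1p2:
  fixes f :: "real ^ 'n::finite \<Rightarrow> complex ^ 'd::finite ^ 'd"
  assumes "\<And>x. hermitian (f x)"
    and "\<And>j k. smooth (\<lambda>x. f x $ j $ k)"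
    and "\<And>j k. square_integrable std_gaussian (\<lambda>x. f x $ j $ k)"
    and "\<And>i j k. smooth (partial_deriv i (\<lambda>x. f x $ j $ k))"
    and "\<And>i j k. square_integrable std_gaussian (partial_deriv i (\<lambda>x. f x $ j $ k))"
  shows "matrix_variance std_gaussian f \<preceq>
    matrix_integral std_gaussian
      (\<lambda>x. \<Sum>i\<in>UNIV. matrix_partial_deriv i f x ** matrix_partial_deriv i f x)"
proof -
  interpret prob_space "std_gaussian :: (real ^ 'n) measure"
    by (rule prob_space_std_gaussian)
  let ?M = "std_gaussian :: (real ^ 'n) measure"
  let ?d = "\<lambda>i. matrix_partial_deriv i f"
  \<comment> \<open>Successor levels of \<open>C_k\<close> give total differentiability, level 0
    gives continuity.\<close>
  have diff: "(\<lambda>y. f y $ j $ k) differentiable (at x)" for j k x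
    using assms(2)[of j k] unfolding smooth_def by (metis C_k.simps(2))
  have cont: "continuous_on UNIV (\<lambda>y. f y $ j $ k)" for j k
    using assms(2)[of j k] unfolding smooth_def by (metis C_k.simps(1))
  have cont': "continuous_on UNIV (\<lambda>y. ?d i y $ j $ k)" for i j k
    using assms(4)[of i j k] unfolding smooth_def matrix_partial_deriv_def
    by simp (metis (no_types, lifting) C_k.simps(1))
  have sq': "square_integrable ?M (\<lambda>x. ?d i x $ j $ k)" for i j k
    using assms(5) by (simp add: matrix_partial_deriv_def)
  have herm': "hermitian (?d i x)" for i x
    using assms(1) diff by (rule hermitian_matrix_partial_deriv)
  have deriv: "((\<lambda>t. (f (c + t *\<^sub>R axis i 1) *v v) $ j) has_vector_derivative
      (?d i (c + s *\<^sub>R axis i 1) *v v) $ j) (at s)" for c i s v j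
    unfolding matrix_vector_mult_def vec_lambda_beta matrix_partial_deriv_def
    by (intro has_vector_derivative_sum has_vector_derivative_mult_left
        partial_deriv_along_axis[where g = "\<lambda>y. f y $ _ $ _"] diff)
  have poincare: "(\<integral>x. (cmod ((f x *v v) $ j))\<^sup>2 \<partial>?M) - (cmod (\<integral>x. (f x *v v) $ j \<partial>?M))\<^sup>2 \<le>
      (\<Sum>i\<in>UNIV. \<integral>x. (cmod ((?d i x *v v) $ j))\<^sup>2 \<partial>?M)" for v j
  proof (rule gaussian_poincare[OF deriv])
    show "continuous_on UNIV (\<lambda>x. (f x *v v) $ j)" "continuous_on UNIV (\<lambda>x. (?d i x *v v) $ j)" for i
      unfolding matrix_vector_mult_def by (simp_all add: continuous_intros cont cont')
  qed (intro square_integrable_matrix_vector_mult assms(3) sq')+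
  have herm: "hermitian (matrix_integral ?M (\<lambda>x. \<Sum>i\<in>UNIV. ?d i x ** ?d i x) - matrix_variance ?M f)"
    unfolding matrix_variance_def
    by (intro hermitian_diff hermitian_matrix_integral hermitian_sum hermitian_square herm' assms(1))
  have "0 \<le> Re (quad_form v (matrix_integral ?M (\<lambda>x. \<Sum>i\<in>UNIV. ?d i x ** ?d i x) - matrix_variance ?M f))"
    for v
  proof -
    \<comment> \<open>The integral splits over \<open>i\<close> because products of square
      integrable entries are integrable.\<close>
    have "matrix_integral ?M (\<lambda>x. \<Sum>i\<in>UNIV. ?d i x ** ?d i x) =
        (\<Sum>i\<in>UNIV. matrix_integral ?M (\<lambda>x. ?d i x ** ?d i x))"
      using integrable_matrix_square[OF sq']
      by (simp add: vec_eq_iff matrix_integral_def sum_component)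
    then have rhs: "Re (quad_form v (matrix_integral ?M (\<lambda>x. \<Sum>i\<in>UNIV. ?d i x ** ?d i x))) =
        (\<Sum>i\<in>UNIV. \<Sum>j\<in>UNIV. \<integral>x. (cmod ((?d i x *v v) $ j))\<^sup>2 \<partial>?M)"
      by (simp add: quad_form_sum quad_form_integral_square[OF herm' sq'] del: of_real_sum flip: of_real_sum)
    \<comment> \<open>By this identity the square of the mean matrix contributes the squared moduli
      of the means of the components, so the form of the matrix variance is a sum of scalar
      variances.\<close>
    have mean: "(matrix_integral ?M f *v v) $ j = (\<integral>x. (f x *v v) $ j \<partial>?M)" for j
      using square_integrable_integrable[OF assms(3)]
      by (simp add: matrix_vector_mult_def matrix_integral_def)
    have lhs: "Re (quad_form v (matrix_variance ?M f)) =
        (\<Sum>j\<in>UNIV. (\<integral>x. (cmod ((f x *v v) $ j))\<^sup>2 \<partial>?M) - (cmod (\<integral>x. (f x *v v) $ j \<partial>?M))\<^sup>2)"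
      unfolding matrix_variance_def quad_form_diff
        quad_form_integral_square[OF assms(1) assms(3)]
        quad_form_square[OF hermitian_matrix_integral[OF assms(1)]] mean
      by (simp add: sum_subtractf)
    have "Re (quad_form v (matrix_variance ?M f)) \<le>
        (\<Sum>j\<in>UNIV. \<Sum>i\<in>UNIV. \<integral>x. (cmod ((?d i x *v v) $ j))\<^sup>2 \<partial>?M)"
      unfolding lhs by (intro sum_mono poincare)
    also have "\<dots> = Re (quad_form v (matrix_integral ?M (\<lambda>x. \<Sum>i\<in>UNIV. ?d i x ** ?d i x)))"
      unfolding rhs by (rule sum.swap)
    finally show ?thesis by (simp add: quad_form_diff)
  qed
  with herm show ?thesis
    by (simp add: psd_le_def positive_semidefinite_def quad_form_def)
qed

end
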